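(* Let $a,b,c,k,l,m$ be positive integers with $c\mid ab$ and $k,l\ge m$, let $h=\frac{a^kb^l}{c^m}$ (a positive integer), and let $d_i^{\pm}=a^{2k}b^{2l}\pm i c^m$ for $i=1,2$, where each $d_i^\pm$ under consideration is a square-free positive integer. (i) For the Pell equation $x^2-d_1^{\pm}y^2=1$, the fundamental solution $(x_1^{\pm1},y_1^{\pm1})$ is $(2ha^kb^l\pm1,\,2h)$, and the other solutions are $(x_n^{\pm1},y_n^{\pm1})$, where $$\frac{x_n^{+1}}{y_n^{+1}}=[a^kb^l;\underbrace{2h,2a^kb^l}_{n-1\text{ times}},2h]\qquad\text{and}\qquad \frac{x_n^{-1}}{y_n^{-1}}=[a^kb^l-1;\underbrace{1,2h-2,1,2a^kb^l-2}_{n-1\text{ times}},1],$$ respectively. (ii) For the Pell equation $x^2-d_2^{\pm}y^2=1$, the fundamental solution $(x_1^{\pm2},y_1^{\pm2})$ is $(ha^kb^l\pm1,\,h)$, and the other solutions are $(x_n^{\pm2},y_n^{\pm2})$, where $$\frac{x_n^{+2}}{y_n^{+2}}=[a^kb^l;\underbrace{h,2a^kb^l}_{n-1\text{ times}},h]\qquad\text{and}\qquad \frac{x_n^{-2}}{y_n^{-2}}=[a^kb^l-1;\underbrace{1,h-2,1,2a^kb^l-2}_{n-1\text{ times}},1],$$ respectively. Here the upper signs go together and the lower signs go together.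
   Context: The fundamental solution of $x^2-dy^2=1$ is the solution $(x_1,y_1)$ in positive integers with least positive values. $[a_0;a_1,\dots,a_r]$ denotes the finite continued fraction $a_0+\cfrac{1}{a_1+\cdots+\cfrac{1}{a_r}}$; an underbraced block is repeated the indicated number of times.
   Formalization: For the lower signs the expansions are corrected to end in 1, t−2, 1 (t = 2h or h) instead of 1, since at n=1 the printed one equals a^k b^l; for d_1^- it is assumed that c ≠ 1, as otherwise (a^k b^l, 1) is fundamental; 1/0 is read as ∞ (d_2^- with h=1). *)

theory Defs
  imports
    Complex_Main
    "HOL-Library.Extended_Real"
    "HOL-Computational_Algebra.Squarefree"
begin

definition pell_solutions :: "int \<Rightarrow> (int \<times> int) set" where
  "pell_solutions d = {(x, y). 0 < x \<and> 0 < y \<and> x\<^sup>2 - d * y\<^sup>2 = 1}"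

definition fundamental_solution :: "int \<Rightarrow> int \<times> int \<Rightarrow> bool" where
  "fundamental_solution d s \<longleftrightarrow>
     s \<in> pell_solutions d \<and>
     (\<forall>(x, y) \<in> pell_solutions d. fst s \<le> x \<and> snd s \<le> y)"

(* The value is taken in ereal, where 1 / 0 = \<infinity> and 1 / \<infinity> = 0.  This matters only for
   partial quotients h - 2 = -1 (h = 1), as in [A - 1; 1, -1, 1] = A - 1 + 1 / (1 + 1 / 0) = A - 1;
   with 1 / 0 = 0 over the reals the value would be A. *)
fun cfrac :: "int list \<Rightarrow> ereal" where
  "cfrac [] = 0"
| "cfrac [a] = ereal (real_of_int a)"
| "cfrac (a # b # xs) = ereal (real_of_int a) + 1 / cfrac (b # xs)"

definition repeat_block :: "nat \<Rightarrow> int list \<Rightarrow> int list" where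
  "repeat_block r B = concat (replicate r B)"

(* The numbers x n and y n are coprime, being a solution, so that the continued fraction q n
   determines them. *)
definition other_solutions_by_cfrac :: "int \<Rightarrow> int \<times> int \<Rightarrow> (nat \<Rightarrow> int list) \<Rightarrow> bool" where
  "other_solutions_by_cfrac d s q \<longleftrightarrow>
     (\<exists>x y :: nat \<Rightarrow> int.
        (x 1, y 1) = s \<and>
        pell_solutions d - {s} = {(x n, y n) | n. 2 \<le> n} \<and>
        (\<forall>n\<ge>1. ereal (real_of_int (x n) / real_of_int (y n)) = cfrac (q n)))"

(* Two corrections of the informal statement, both for the lower sign.
   1. With A = a^k b^l, the printed expansions [A - 1; (1, t - 2, 1, 2A - 2)^(n-1), 1] (t = 2h or h)
      lack the last two partial quotients of the final period; the solutions are given by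
      [A - 1; (1, t - 2, 1, 2A - 2)^(n-1), 1, t - 2, 1].  For n = 1 the printed form has the value
      A, not x_1 / y_1 = A - 1 / t.
   2. For c = 1 the fundamental solution of x^2 - (A^2 - 1) y^2 = 1 is (A, 1), not
      (2 A^2 - 1, 2 A), so the claim for A^2 - c^m needs c \<noteq> 1. *)

end

theory Submission
  imports Defs
begin

text \<open>
  Put \<open>A = a\<^sup>k b\<^sup>l\<close>. All four numbers have the form \<open>d = A\<^sup>2 \<plusminus> s\<close> with
  \<open>s * t = 2 * A\<close>, where \<open>t\<close> is \<open>2 * h\<close> or \<open>h\<close>, and the claimed fundamental solution is
  \<open>(t * A \<plusminus> 1, t)\<close>. Writing a solution as \<open>x = A * y \<plusminus> r\<close> turns the Pell equation into
  \<open>s * y * (t * r - y) = \<plusminus> (1 - r\<^sup>2)\<close>, which is impossible for \<open>y < t\<close>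
  (for the lower sign provided \<open>s \<ge> 2\<close>). The other solutions are the powers of the fundamental
  one, and one more period of the continued fraction acts on \<open>x / y\<close> as multiplication by the
  fundamental solution.
\<close>

section \<open>Solutions of a Pell equation as powers of the fundamental one\<close>

text \<open>The coordinates of \<open>(u + v * sqrt d)^n\<close> for \<open>s = (u, v)\<close>. The
  exponent \<open>0\<close> gives the trivial solution \<open>(1, 0)\<close>, which is not in
  \<open>pell_solutions d\<close>, so statements about solutions start at
  \<open>n = 1\<close>.\<close>

primrec pell_power :: "int \<Rightarrow> int \<times> int \<Rightarrow> nat \<Rightarrow> int \<times> int" where
  "pell_power d s 0 = (1, 0)"
| "pell_power d s (Suc n) =
     (fst s * fst (pell_power d s n) + d * snd s * snd (pell_power d s n),
      fst s * snd (pell_power d s n) + snd s * fst (pell_power d s n))"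

text \<open>Brahmagupta's identity: the norm \<open>x^2 - d * y^2\<close> is multiplicative.\<close>

lemma pell_solutions_mult:
  assumes "(u, v) \<in> pell_solutions d" "(x, y) \<in> pell_solutions d" "0 < d"
  shows "(u * x + d * v * y, u * y + v * x) \<in> pell_solutions d"
proof -
  have "(u * x + d * v * y)\<^sup>2 - d * (u * y + v * x)\<^sup>2 = (u\<^sup>2 - d * v\<^sup>2) * (x\<^sup>2 - d * y\<^sup>2)"
    by algebra
  then show ?thesis
    using assms by (simp add: pell_solutions_def add_pos_pos)
qed

lemma pell_power_mem:
  assumes "s \<in> pell_solutions d" "0 < d" "1 \<le> n"
  shows "pell_power d s n \<in> pell_solutions d"
  using \<open>1 \<le> n\<close>
proof (induction n rule: dec_induct)
  case base
  then show ?case using assms(1) by simp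
next
  case (step n)
  then show ?case
    using pell_solutions_mult[of "fst s" "snd s" d "fst (pell_power d s n)" "snd (pell_power d s n)"]
      assms by simp
qed

text \<open>Ensures that \<open>s\<close> itself does not recur among the powers with exponent at
  least 2.\<close>

lemma snd_pell_power_gt:
  assumes "s \<in> pell_solutions d" "0 < d" "2 \<le> n"
  shows "snd s < snd (pell_power d s n)"
proof -
  obtain k where n: "n = Suc k" and k: "1 \<le> k"
    using \<open>2 \<le> n\<close> by (cases n) auto
  obtain x y where xy: "pell_power d s k = (x, y)" by fastforce
  obtain u v where uv: "s = (u, v)" by fastforce
  have "0 < x" "0 < y" "0 < u" "0 < v"
    using pell_power_mem[OF assms(1,2) k, unfolded xy] assms(1) unfolding uv
    by (simp_all add: pell_solutions_def)
  then have "0 < u * y" "v * 1 \<le> v * x" by simp_all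
  then show ?thesis by (simp add: n xy) (simp add: uv)
qed

text \<open>Division by \<open>u + v * sqrt d\<close>, that is, multiplication by the conjugate
  \<open>u - v * sqrt d\<close>. Positivity of the quotient \<open>(x', y')\<close> follows by
  comparing squares; multiplying back gives \<open>y = u * y' + v * x'\<close>, hence
  \<open>y' < y\<close>.\<close>

lemma pell_solutions_descent:
  assumes "(u, v) \<in> pell_solutions d" "(x, y) \<in> pell_solutions d" "0 < d" "v < y"
  shows "(u * x - d * v * y, u * y - v * x) \<in> pell_solutions d" "u * y - v * x < y"
proof -
  define x' y' where "x' = u * x - d * v * y" and "y' = u * y - v * x"
  have pos: "0 < u" "0 < v" "0 < x" "0 < y"
    and eqs: "u\<^sup>2 = 1 + d * v\<^sup>2" "x\<^sup>2 = 1 + d * y\<^sup>2"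
    using assms by (auto simp: pell_solutions_def)
  have "(u * x)\<^sup>2 - (d * v * y)\<^sup>2 = 1 + d * v\<^sup>2 + d * y\<^sup>2"
    unfolding power_mult_distrib eqs by algebra
  also have "\<dots> > 0" using \<open>0 < d\<close> by (simp add: add_pos_nonneg)
  finally have "(d * v * y)\<^sup>2 < (u * x)\<^sup>2" by simp
  then have x': "0 < x'"
    using power2_less_imp_less[of "d * v * y" "u * x"] pos by (simp add: x'_def)
  have "(u * y)\<^sup>2 - (v * x)\<^sup>2 = y\<^sup>2 - v\<^sup>2"
    unfolding power_mult_distrib eqs by algebra
  also have "\<dots> > 0" using \<open>v < y\<close> pos by (simp add: power_strict_mono)
  finally have "(v * x)\<^sup>2 < (u * y)\<^sup>2" by simp
  then have y': "0 < y'"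
    using power2_less_imp_less[of "v * x" "u * y"] pos by (simp add: y'_def)
  have "x'\<^sup>2 - d * y'\<^sup>2 = (u\<^sup>2 - d * v\<^sup>2) * (x\<^sup>2 - d * y\<^sup>2)"
    unfolding x'_def y'_def by algebra
  then have "x'\<^sup>2 - d * y'\<^sup>2 = 1" using eqs by simp
  with x' y' show "(u * x - d * v * y, u * y - v * x) \<in> pell_solutions d"
    by (simp add: pell_solutions_def x'_def y'_def)
  have "u * y' + v * x' = (u\<^sup>2 - d * v\<^sup>2) * y"
    unfolding x'_def y'_def by algebra
  then have "u * y' + v * x' = y" using eqs by simp
  moreover have "1 * y' \<le> u * y'" using pos y' by (intro mult_right_mono) auto
  moreover have "0 < v * x'" using pos x' by simp
  ultimately show "u * y - v * x < y" by (simp add: y'_def)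
qed

text \<open>Divide by the fundamental solution as long as \<open>y\<close> exceeds \<open>v\<close>.
  By minimality this stops exactly at \<open>y = v\<close>, where the equation forces
  \<open>x = u\<close>.\<close>

lemma pell_solution_is_power:
  assumes "fundamental_solution d s" "0 < d" "(x, y) \<in> pell_solutions d"
  shows "\<exists>n\<ge>1. (x, y) = pell_power d s n"
  using assms(3)
proof (induction "nat y" arbitrary: x y rule: less_induct)
  case less
  obtain u v where s: "s = (u, v)" by fastforce
  have uv: "(u, v) \<in> pell_solutions d"
    and min: "v \<le> y"
    using assms(1) less.prems by (auto simp: fundamental_solution_def s)
  have pos: "0 < u" "0 < x" "0 < y"
    and eqs: "u\<^sup>2 = 1 + d * v\<^sup>2" "x\<^sup>2 = 1 + d * y\<^sup>2"
    using uv less.prems by (auto simp: pell_solutions_def)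
  show ?case
  proof (cases "v = y")
    case True
    then have "x = u" using eqs pos power2_eq_iff_nonneg[of x u] by simp
    then show ?thesis using True by (intro exI[of _ 1]) (simp add: s)
  next
    case False
    then have "v < y" using min by simp
    note descent = pell_solutions_descent[OF uv less.prems \<open>0 < d\<close> this]
    define x' y' where "x' = u * x - d * v * y" and "y' = u * y - v * x"
    have "nat y' < nat y" using descent(2) pos by (simp add: y'_def)
    then obtain n where n: "1 \<le> n" "(x', y') = pell_power d s n"
      using less.hyps[of y' x'] descent(1) by (auto simp: x'_def y'_def)
    have "u * x' + d * v * y' = (u\<^sup>2 - d * v\<^sup>2) * x" "u * y' + v * x' = (u\<^sup>2 - d * v\<^sup>2) * y"
      unfolding x'_def y'_def by algebra+
    then have "(x, y) = pell_power d s (Suc n)"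
      using eqs by (simp add: n(2)[symmetric] flip: s)
        (simp add: s)
    then show ?thesis by (intro exI[of _ "Suc n"]) simp
  qed
qed

lemma other_solutions_by_cfracI:
  assumes "fundamental_solution d s" "0 < d"
    and cf: "\<And>n. 1 \<le> n \<Longrightarrow>
      ereal (real_of_int (fst (pell_power d s n)) / real_of_int (snd (pell_power d s n))) = cfrac (q n)"
  shows "other_solutions_by_cfrac d s q"
proof -
  have s: "s \<in> pell_solutions d" using assms(1) by (simp add: fundamental_solution_def)
  have "pell_solutions d - {s} = {pell_power d s n | n. 2 \<le> n}"
  proof (intro equalityI subsetI)
    fix p assume p: "p \<in> pell_solutions d - {s}"
    then obtain n where n: "1 \<le> n" "p = pell_power d s n"
      using pell_solution_is_power[OF assms(1,2), of "fst p" "snd p"] by auto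
    then have "n \<noteq> 1" using p by auto
    then show "p \<in> {pell_power d s n | n. 2 \<le> n}" using n by force
  next
    fix p assume "p \<in> {pell_power d s n | n. 2 \<le> n}"
    then obtain n where "2 \<le> n" "p = pell_power d s n" by blast
    then show "p \<in> pell_solutions d - {s}"
      using pell_power_mem[OF s \<open>0 < d\<close>, of n] snd_pell_power_gt[OF s \<open>0 < d\<close>, of n] by auto
  qed
  then show ?thesis
    unfolding other_solutions_by_cfrac_def
    by (intro exI[of _ "\<lambda>n. fst (pell_power d s n)"] exI[of _ "\<lambda>n. snd (pell_power d s n)"])
      (simp add: cf)
qed

text \<open>Minimality of \<open>y\<close> suffices, because \<open>x^2 = 1 + d * y^2\<close> makes
  \<open>x\<close> grow with \<open>y\<close>.\<close>

lemma fundamental_solutionI: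
  assumes "(u, v) \<in> pell_solutions d" "0 < d"
    and min: "\<And>x y. (x, y) \<in> pell_solutions d \<Longrightarrow> v \<le> y"
  shows "fundamental_solution d (u, v)"
proof -
  have "u \<le> x" if xy: "(x, y) \<in> pell_solutions d" for x y
  proof -
    have "v\<^sup>2 \<le> y\<^sup>2"
      using min[OF xy] assms(1) by (simp add: pell_solutions_def power_mono)
    then have "d * v\<^sup>2 \<le> d * y\<^sup>2"
      using \<open>0 < d\<close> by simp
    moreover have "u\<^sup>2 - d * v\<^sup>2 = 1" "x\<^sup>2 - d * y\<^sup>2 = 1"
      using assms(1) xy by (simp_all add: pell_solutions_def)
    ultimately have "u\<^sup>2 \<le> x\<^sup>2" by linarith
    then show ?thesis
      using xy power2_le_imp_le[of u x] by (simp add: pell_solutions_def)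
  qed
  then show ?thesis
    using assms(1) min by (auto simp: fundamental_solution_def)
qed

section \<open>Evaluation of continued fractions\<close>

lemma cfrac_Cons:
  "xs \<noteq> [] \<Longrightarrow> cfrac (a # xs) = ereal (real_of_int a) + 1 / cfrac xs"
  by (cases xs) auto

lemma repeat_block_Suc: "repeat_block (Suc n) B = B @ repeat_block n B"
  by (simp add: repeat_block_def)

lemma one_divide_ereal: "r \<noteq> 0 \<Longrightarrow> 1 / ereal r = ereal (1 / r)"
  by (simp add: one_ereal_def)

text \<open>Recovers the contribution of the tail from the value of a continued fraction, so that
  its first partial quotient can be exchanged.\<close>

lemma ereal_add_left_eqD: "ereal p + z = ereal r \<Longrightarrow> z = ereal (r - p)"
  by (cases z) auto

section \<open>The case \<open>d = A\<^sup>2 + s\<close> with \<open>s\<close> dividing \<open>2 * A\<close>\<close>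

context
  fixes A s t d :: int
  assumes A: "0 < A" and s: "0 < s" and st: "s * t = 2 * A" and d: "d = A\<^sup>2 + s"
begin

lemma t_pos_plus: "0 < t"
  using A s st by (metis mult_pos_pos zero_less_mult_pos zero_less_numeral)

lemma d_pos_plus: "0 < d"
  using s by (simp add: d add_nonneg_pos)

lemma fundamental_solution_plus: "fundamental_solution d (t * A + 1, t)"
proof (rule fundamental_solutionI)
  have "(t * A + 1)\<^sup>2 - d * t\<^sup>2 = 1 + t * (2 * A - s * t)"
    unfolding d by algebra
  then show "(t * A + 1, t) \<in> pell_solutions d"
    using A t_pos_plus st by (simp add: pell_solutions_def add_pos_pos)
next
  fix x y assume "(x, y) \<in> pell_solutions d"
  then have pos: "0 < x" "0 < y" and eq: "x\<^sup>2 = (A\<^sup>2 + s) * y\<^sup>2 + 1"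
    by (auto simp: pell_solutions_def d)
  define r where "r = x - A * y"
  have "x\<^sup>2 = (A * y)\<^sup>2 + s * y\<^sup>2 + 1" unfolding eq by algebra
  moreover have "0 < s * y\<^sup>2" using s pos by simp
  ultimately have "(A * y)\<^sup>2 < x\<^sup>2" by simp
  then have "A * y < x" using power2_less_imp_less[of "A * y" x] pos by simp
  then have r: "1 \<le> r" by (simp add: r_def)
  \<comment> \<open>Insert \<open>x = A * y + r\<close> and \<open>2 * A = s * t\<close> into the
    equation. For \<open>y < t\<close> the left side would be positive, while the right side is at
    most 0.\<close>
  have key: "s * y * (t * r - y) = 1 - r\<^sup>2"
    using eq st unfolding r_def by algebra
  show "t \<le> y"
  proof (rule ccontr)
    assume "\<not> t \<le> y"
    moreover have "t * 1 \<le> t * r" using r t_pos_plus by (intro mult_left_mono) auto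
    ultimately have "0 < t * r - y" by linarith
    then have "0 < s * y * (t * r - y)" using s pos by simp
    moreover have "1 \<le> r\<^sup>2" using r by simp
    ultimately show False using key by simp
  qed
qed (rule d_pos_plus)

text \<open>A block is added at the front: if the old value is \<open>z = x / y\<close>, the new one
  is \<open>A + 1 / (t + 1 / (A + z))\<close>. This fractional linear map is multiplication of
  \<open>x + y * sqrt d\<close> by the fundamental solution.\<close>

lemma cfrac_plus:
  "ereal (real_of_int (fst (pell_power d (t * A + 1, t) (Suc n))) /
          real_of_int (snd (pell_power d (t * A + 1, t) (Suc n)))) =
   cfrac (A # repeat_block n [t, 2 * A] @ [t])"
proof (induction n)
  case 0
  show ?case
    using t_pos_plus by (simp add: repeat_block_def one_divide_ereal field_simps)
next
  case (Suc n)
  obtain x y where xy: "pell_power d (t * A + 1, t) (Suc n) = (x, y)" by fastforce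
  have "(x, y) \<in> pell_solutions d"
    using pell_power_mem[of "(t * A + 1, t)" d "Suc n"] fundamental_solution_plus d_pos_plus
    by (simp add: xy fundamental_solution_def del: pell_power.simps)
  then have "0 < x" "0 < y" by (auto simp: pell_solutions_def)
  define X Y B T where "X = real_of_int x" and "Y = real_of_int y"
    and "B = real_of_int A" and "T = real_of_int t"
  have pos: "0 < X" "0 < Y" "0 < B" "0 < T"
    using \<open>0 < x\<close> \<open>0 < y\<close> A t_pos_plus by (simp_all add: X_def Y_def B_def T_def)
  let ?L = "repeat_block n [t, 2 * A] @ [t]"
  have "ereal B + 1 / cfrac ?L = ereal (X / Y)"
    using Suc.IH by (simp add: xy X_def Y_def B_def cfrac_Cons del: pell_power.simps)
  \<comment> \<open>In the longer fraction the tail \<open>?L\<close> follows \<open>2 * A\<close>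
    instead of \<open>A\<close>.\<close>
  then have L: "1 / cfrac ?L = ereal (X / Y - B)"
    by (rule ereal_add_left_eqD)
  have D: "0 < T * (B * Y + X) + Y" "0 < B * Y + X"
    using pos by (simp_all add: add_pos_pos)
  \<comment> \<open>This removes \<open>s\<close>: the recurrence contains \<open>d\<close> only
    through \<open>d * t\<close>.\<close>
  have d': "real_of_int d * T = T * B\<^sup>2 + 2 * B"
  proof -
    have "d * t = t * A\<^sup>2 + 2 * A" unfolding d using st by algebra
    then show ?thesis
      unfolding T_def B_def by (metis of_int_add of_int_mult of_int_numeral of_int_power)
  qed
  have "cfrac (2 * A # ?L) = ereal ((B * Y + X) / Y)"
    using pos by (simp add: cfrac_Cons L flip: B_def) (simp add: field_simps)
  then have "cfrac (t # 2 * A # ?L) = ereal ((T * (B * Y + X) + Y) / (B * Y + X))"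
    using pos D by (simp add: cfrac_Cons[of "2 * A # ?L"] one_divide_ereal flip: T_def)
      (simp add: field_simps)
  then have "cfrac (A # t # 2 * A # ?L) = ereal (B + (B * Y + X) / (T * (B * Y + X) + Y))"
    using pos D by (simp add: cfrac_Cons[of "t # 2 * A # ?L"] one_divide_ereal flip: B_def)
  also have "B + (B * Y + X) / (T * (B * Y + X) + Y) =
      ((T * B + 1) * X + real_of_int d * T * Y) / ((T * B + 1) * Y + T * X)"
    using D unfolding d' by (simp add: field_simps power2_eq_square)
  finally show ?case
    by (simp add: pell_power.simps(2)[of _ _ "Suc n"] xy repeat_block_Suc X_def Y_def B_def T_def
        del: pell_power.simps)
qed

lemma other_solutions_plus:
  "other_solutions_by_cfrac d (t * A + 1, t) (\<lambda>n. A # repeat_block (n - 1) [t, 2 * A] @ [t])"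
proof (rule other_solutions_by_cfracI[OF fundamental_solution_plus d_pos_plus])
  fix n :: nat assume "1 \<le> n"
  then show "ereal (real_of_int (fst (pell_power d (t * A + 1, t) n)) /
      real_of_int (snd (pell_power d (t * A + 1, t) n))) =
    cfrac (A # repeat_block (n - 1) [t, 2 * A] @ [t])"
    using cfrac_plus[of "n - 1"] by simp
qed

end

section \<open>The case \<open>d = A\<^sup>2 - s\<close> with \<open>s \<ge> 2\<close> dividing \<open>2 * A\<close>\<close>

context
  fixes A s t d :: int
  assumes A: "0 < A" and s: "2 \<le> s" and st: "s * t = 2 * A" and d: "d = A\<^sup>2 - s"
    and d_pos: "0 < d"
begin

lemma t_pos_minus: "0 < t"
  using A s st
  by (metis mult_pos_pos zero_less_mult_pos zero_less_numeral order_less_le_trans)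

text \<open>Makes \<open>t * A - 1\<close> positive even for \<open>t = 1\<close>.\<close>

lemma A_ge_minus: "2 \<le> A"
proof (rule ccontr)
  assume "\<not> 2 \<le> A"
  then have "A = 1" using A by simp
  then show False using d d_pos s by simp
qed

lemma fundamental_solution_minus: "fundamental_solution d (t * A - 1, t)"
proof (rule fundamental_solutionI)
  have "(t * A - 1)\<^sup>2 - d * t\<^sup>2 = 1 - t * (2 * A - s * t)"
    unfolding d by algebra
  moreover have "1 * 2 \<le> t * A"
    using A_ge_minus t_pos_minus by (intro mult_mono) auto
  ultimately show "(t * A - 1, t) \<in> pell_solutions d"
    using t_pos_minus st by (simp add: pell_solutions_def)
next
  fix x y assume "(x, y) \<in> pell_solutions d"
  then have pos: "0 < x" "0 < y" and eq: "x\<^sup>2 = (A\<^sup>2 - s) * y\<^sup>2 + 1"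
    by (auto simp: pell_solutions_def d)
  define r where "r = A * y - x"
  have "x\<^sup>2 = (A * y)\<^sup>2 - s * y\<^sup>2 + 1" unfolding eq by algebra
  \<comment> \<open>Here \<open>s \<ge> 2\<close> enters: for \<open>s = 1\<close> the pair
    \<open>(A, 1)\<close> is a solution with \<open>r = 0\<close>.\<close>
  moreover have "2 * 1 \<le> s * y\<^sup>2"
    using s pos by (intro mult_mono) (auto simp: int_one_le_iff_zero_less)
  ultimately have "x\<^sup>2 < (A * y)\<^sup>2" by simp
  then have "x < A * y" using power2_less_imp_less[of x "A * y"] pos A by simp
  then have r: "1 \<le> r" by (simp add: r_def)
  have key: "s * y * (t * r - y) = (r - 1) * (r + 1)"
    using eq st unfolding r_def by algebra
  show "t \<le> y"
  proof (rule ccontr)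
    assume "\<not> t \<le> y"
    then have "s * y * (t * r - t) < s * y * (t * r - y)"
      using s pos by simp
    \<comment> \<open>With \<open>y\<close> replaced by \<open>t\<close>, both sides share the
      factor \<open>r - 1\<close>. Cancelling it leaves \<open>2 * A * y < r + 1\<close>, which
      contradicts \<open>r = A * y - x\<close>.\<close>
    moreover have "s * y * (t * r - t) = (r - 1) * (2 * A * y)"
      using st by algebra
    ultimately have "(r - 1) * (2 * A * y) < (r - 1) * (r + 1)"
      using key by simp
    then have "2 * (A * y) < r + 1"
      using r by (simp add: mult_less_cancel_left)
    then show False using pos r by (simp add: r_def)
  qed
qed (rule d_pos)

text \<open>Multiplication by the fundamental solution is now
  \<open>z \<mapsto> A - 1 / (t - 1 / (A + z))\<close>. Turning the two minus signs into plus signs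
  produces the quotients \<open>1, t - 2, 1\<close> and lowers \<open>A\<close> to
  \<open>A - 1\<close> and \<open>2 * A\<close> to \<open>2 * A - 2\<close>.\<close>

lemma cfrac_minus:
  "ereal (real_of_int (fst (pell_power d (t * A - 1, t) (Suc n))) /
          real_of_int (snd (pell_power d (t * A - 1, t) (Suc n)))) =
   cfrac ((A - 1) # repeat_block n [1, t - 2, 1, 2 * A - 2] @ [1, t - 2, 1])"
proof (induction n)
  case 0
  show ?case
  proof (cases "t = 1")
    case True
    \<comment> \<open>The inner quotient \<open>1 / (t - 2 + 1)\<close> is infinite here.\<close>
    then show ?thesis
      by (simp add: repeat_block_def one_ereal_def)
  next
    case False
    define T B where "T = real_of_int t" and "B = real_of_int A"
    have "2 \<le> t" using False t_pos_minus by simp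
    then have T: "1 < T" by (simp add: T_def)
    have "cfrac [t - 2, 1] = ereal (T - 1)"
      by (simp add: T_def one_ereal_def)
    then have "cfrac [1, t - 2, 1] = ereal (T / (T - 1))"
      using T by (simp add: cfrac_Cons[of "[t - 2, 1]"] one_divide_ereal) (simp add: field_simps)
    then have "cfrac [A - 1, 1, t - 2, 1] = ereal (B - 1 + (T - 1) / T)"
      using T by (simp add: cfrac_Cons[of "[1, t - 2, 1]"] one_divide_ereal B_def)
    also have "B - 1 + (T - 1) / T = (T * B - 1) / T"
      using T by (simp add: field_simps)
    finally show ?thesis
      by (simp add: repeat_block_def T_def B_def)
  qed
next
  case (Suc n)
  obtain x y where xy: "pell_power d (t * A - 1, t) (Suc n) = (x, y)" by fastforce
  have "(x, y) \<in> pell_solutions d"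
    using pell_power_mem[of "(t * A - 1, t)" d "Suc n"] fundamental_solution_minus d_pos
    by (simp add: xy fundamental_solution_def del: pell_power.simps)
  then have "0 < x" "0 < y" by (auto simp: pell_solutions_def)
  define X Y B T where "X = real_of_int x" and "Y = real_of_int y"
    and "B = real_of_int A" and "T = real_of_int t"
  have pos: "0 < X" "0 < Y" "2 \<le> B" "1 \<le> T"
    using \<open>0 < x\<close> \<open>0 < y\<close> A_ge_minus t_pos_minus by (simp_all add: X_def Y_def B_def T_def)
  let ?L = "repeat_block n [1, t - 2, 1, 2 * A - 2] @ [1, t - 2, 1]"
  have "ereal (B - 1) + 1 / cfrac ?L = ereal (X / Y)"
    using Suc.IH by (simp add: xy X_def Y_def B_def cfrac_Cons del: pell_power.simps)
  \<comment> \<open>Stated for the reciprocal, since \<open>cfrac ?L\<close> itself is infinite when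
    \<open>t = 1\<close> and \<open>n = 0\<close>.\<close>
  then have L: "1 / cfrac ?L = ereal (X / Y - (B - 1))"
    by (rule ereal_add_left_eqD)
  \<comment> \<open>From the inside outwards the tails take the values \<open>(P - Y) / Y\<close>,
    \<open>P / (P - Y)\<close>, \<open>Q / P\<close> and \<open>R / Q\<close>. Here
    \<open>P / Y = A + x / y\<close>, and \<open>R\<close> is the second coordinate of the next
    power.\<close>
  define P Q R where "P = B * Y + X" and "Q = (T - 1) * P - Y" and "R = T * P - Y"
  have "2 * Y \<le> B * Y" using pos by simp
  then have PY: "Y < P" "0 < P" using pos(1,2) unfolding P_def by linarith+
  have "1 * P \<le> T * P" using pos PY by (intro mult_right_mono) auto
  then have R: "0 < R" using PY unfolding R_def by linarith
  \<comment> \<open>For \<open>t = 1\<close> one has \<open>Q = - Y\<close>, negative but nonzero,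
    so its reciprocal is finite.\<close>
  have Q: "Q \<noteq> 0"
  proof (cases "t = 1")
    case True
    then show ?thesis using pos by (simp add: Q_def T_def)
  next
    case False
    then have "2 \<le> t" using t_pos_minus by simp
    then have "2 \<le> T" by (simp add: T_def)
    then have "1 * P \<le> (T - 1) * P" using PY by (intro mult_right_mono) auto
    then have "0 < Q" using PY unfolding Q_def by linarith
    then show ?thesis by simp
  qed
  have d': "real_of_int d * T = T * B\<^sup>2 - 2 * B"
  proof -
    have "d * t = t * A\<^sup>2 - 2 * A" unfolding d using st by algebra
    then show ?thesis
      unfolding T_def B_def by (metis of_int_diff of_int_mult of_int_numeral of_int_power)
  qed
  have "cfrac ((2 * A - 2) # ?L) = ereal ((P - Y) / Y)"
    using pos by (simp add: cfrac_Cons L flip: B_def) (simp add: P_def field_simps)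
  then have "cfrac (1 # (2 * A - 2) # ?L) = ereal (P / (P - Y))"
    using pos PY by (simp add: cfrac_Cons[of "(2 * A - 2) # ?L"] one_divide_ereal)
      (simp add: field_simps)
  then have "cfrac ((t - 2) # 1 # (2 * A - 2) # ?L) = ereal (Q / P)"
    using pos PY by (simp add: cfrac_Cons[of "1 # (2 * A - 2) # ?L"] one_divide_ereal flip: T_def)
      (simp add: Q_def field_simps)
  then have "cfrac (1 # (t - 2) # 1 # (2 * A - 2) # ?L) = ereal (R / Q)"
    using Q PY by (simp add: cfrac_Cons[of "(t - 2) # 1 # (2 * A - 2) # ?L"] one_divide_ereal)
      (simp add: Q_def R_def field_simps)
  then have "cfrac ((A - 1) # 1 # (t - 2) # 1 # (2 * A - 2) # ?L) = ereal (B - 1 + Q / R)"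
    using Q R by (simp add: cfrac_Cons[of "1 # (t - 2) # 1 # (2 * A - 2) # ?L"] one_divide_ereal
        flip: B_def)
  also have "B - 1 + Q / R = ((B - 1) * R + Q) / R"
    using R by (simp add: field_simps)
  also have "(B - 1) * R + Q = (T * B - 1) * X + real_of_int d * T * Y"
    unfolding d' P_def Q_def R_def by algebra
  also have "R = (T * B - 1) * Y + T * X"
    unfolding P_def R_def by algebra
  finally show ?case
    by (simp add: pell_power.simps(2)[of _ _ "Suc n"] xy repeat_block_Suc X_def Y_def B_def T_def
        del: pell_power.simps)
qed

lemma other_solutions_minus:
  "other_solutions_by_cfrac d (t * A - 1, t)
     (\<lambda>n. (A - 1) # repeat_block (n - 1) [1, t - 2, 1, 2 * A - 2] @ [1, t - 2, 1])"
proof (rule other_solutions_by_cfracI[OF fundamental_solution_minus d_pos])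
  fix n :: nat assume "1 \<le> n"
  then show "ereal (real_of_int (fst (pell_power d (t * A - 1, t) n)) /
      real_of_int (snd (pell_power d (t * A - 1, t) n))) =
    cfrac ((A - 1) # repeat_block (n - 1) [1, t - 2, 1, 2 * A - 2] @ [1, t - 2, 1])"
    using cfrac_minus[of "n - 1"] by simp
qed

end

section \<open>Application to \<open>A = a^k * b^l\<close> with \<open>s = c^m\<close> and
  \<open>s = 2 * c^m\<close>\<close>

theorem theorem4p4:
  fixes a b c h d1p d1m d2p d2m :: int and k l m :: nat
  assumes "0 < a" "0 < b" "0 < c" "0 < k" "0 < l" "0 < m"
    and "c dvd a * b" and "m \<le> k" and "m \<le> l"
    and h: "h = (a ^ k * b ^ l) div c ^ m"
    and d1p: "d1p = a ^ (2 * k) * b ^ (2 * l) + c ^ m"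
    and d1m: "d1m = a ^ (2 * k) * b ^ (2 * l) - c ^ m"
    and d2p: "d2p = a ^ (2 * k) * b ^ (2 * l) + 2 * c ^ m"
    and d2m: "d2m = a ^ (2 * k) * b ^ (2 * l) - 2 * c ^ m"
  shows "(c ^ m dvd a ^ k * b ^ l \<and> 0 < h) \<and>
    (0 < d1p \<and> squarefree d1p \<longrightarrow>
      fundamental_solution d1p (2 * h * a ^ k * b ^ l + 1, 2 * h) \<and>
      other_solutions_by_cfrac d1p (2 * h * a ^ k * b ^ l + 1, 2 * h)
        (\<lambda>n. a ^ k * b ^ l #
             repeat_block (n - 1) [2 * h, 2 * a ^ k * b ^ l] @ [2 * h])) \<and>
    (0 < d1m \<and> squarefree d1m \<and> c \<noteq> 1 \<longrightarrow>
      fundamental_solution d1m (2 * h * a ^ k * b ^ l - 1, 2 * h) \<and>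
      other_solutions_by_cfrac d1m (2 * h * a ^ k * b ^ l - 1, 2 * h)
        (\<lambda>n. (a ^ k * b ^ l - 1) #
             repeat_block (n - 1) [1, 2 * h - 2, 1, 2 * a ^ k * b ^ l - 2] @ [1, 2 * h - 2, 1])) \<and>
    (0 < d2p \<and> squarefree d2p \<longrightarrow>
      fundamental_solution d2p (h * a ^ k * b ^ l + 1, h) \<and>
      other_solutions_by_cfrac d2p (h * a ^ k * b ^ l + 1, h)
        (\<lambda>n. a ^ k * b ^ l #
             repeat_block (n - 1) [h, 2 * a ^ k * b ^ l] @ [h])) \<and>
    (0 < d2m \<and> squarefree d2m \<longrightarrow>
      fundamental_solution d2m (h * a ^ k * b ^ l - 1, h) \<and>
      other_solutions_by_cfrac d2m (h * a ^ k * b ^ l - 1, h)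
        (\<lambda>n. (a ^ k * b ^ l - 1) #
             repeat_block (n - 1) [1, h - 2, 1, 2 * a ^ k * b ^ l - 2] @ [1, h - 2, 1]))"
proof -
  define A C where "A = a ^ k * b ^ l" and "C = c ^ m"
  have A: "0 < A" and C: "0 < C" using assms(1-3) by (simp_all add: A_def C_def)
  have "c ^ m dvd (a * b) ^ m" using \<open>c dvd a * b\<close> by (rule dvd_power_same)
  also have "\<dots> dvd a ^ k * b ^ l"
    unfolding power_mult_distrib
    using \<open>m \<le> k\<close> \<open>m \<le> l\<close> by (intro mult_dvd_mono le_imp_power_dvd)
  finally have dvd: "C dvd A" by (simp add: A_def C_def)
  then have hC: "C * h = A" by (simp add: h A_def C_def)
  then have h_pos: "0 < h" using A C by (metis zero_less_mult_pos)
  have sq: "a ^ (2 * k) * b ^ (2 * l) = A\<^sup>2"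
    by (simp add: A_def power_mult_distrib power_mult[symmetric] mult.commute)
  have C2: "2 \<le> C" if "c \<noteq> 1"
  proof -
    have "1 < c" using that \<open>0 < c\<close> by simp
    then have "1 < C" using \<open>0 < m\<close> by (simp add: C_def)
    then show ?thesis by simp
  qed
  \<comment> \<open>The two factorisations \<open>s * t = 2 * A\<close>: \<open>t = 2 * h\<close>
    belongs to the \<open>d1\<close> cases and \<open>t = h\<close> to the \<open>d2\<close> cases.
    The bound \<open>s \<ge> 2\<close> for the lower sign comes from \<open>c \<noteq> 1\<close> in
    the first case and from the factor 2 in the second.\<close>
  have st: "C * (2 * h) = 2 * A" "2 * C * h = 2 * A" using hC by simp_all
  have assoc: "2 * h * a ^ k * b ^ l = 2 * h * A" "h * a ^ k * b ^ l = h * A"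
    "2 * a ^ k * b ^ l = 2 * A" "a ^ k * b ^ l = A" "c ^ m = C"
    by (simp_all add: A_def C_def)
  have d1p': "d1p = A\<^sup>2 + C" and d1m': "d1m = A\<^sup>2 - C"
    and d2p': "d2p = A\<^sup>2 + 2 * C" and d2m': "d2m = A\<^sup>2 - 2 * C"
    by (simp_all only: d1p d1m d2p d2m sq C_def)
  have C': "0 < 2 * C" "2 \<le> 2 * C" using C by simp_all
  show ?thesis
    unfolding assoc
    using dvd h_pos C2
      fundamental_solution_plus[OF A C st(1) d1p'] other_solutions_plus[OF A C st(1) d1p']
      fundamental_solution_minus[OF A _ st(1) d1m'] other_solutions_minus[OF A _ st(1) d1m']
      fundamental_solution_plus[OF A C'(1) st(2) d2p'] other_solutions_plus[OF A C'(1) st(2) d2p']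
      fundamental_solution_minus[OF A C'(2) st(2) d2m'] other_solutions_minus[OF A C'(2) st(2) d2m']
    by blast
qed

end
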